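(* Let $\mathcal G=([m],E)$ be a directed tree with the constant coloring $c^*$. Then $\mathcal G$ can be recovered from the degree $1$ component of the vanishing ideal $I_{\varphi_{\mathcal G,c^*}}$ of $\mathcal V_{\varphi_{\mathcal G,c^*}}$; that is, if $\mathcal H$ is a directed tree on $[m]$ such that the same linear forms in $\mathbb R[\sigma_{ij}:1\le i\le j\le m]$ vanish on $\mathcal V_{\varphi_{\mathcal G,c^*}}$ and on $\mathcal V_{\varphi_{\mathcal H,c^*}}$, then $\mathcal H=\mathcal G$.
   Context: A directed tree $\mathcal G=([m],E)$ is a directed acyclic graph on the labeled vertex set $[m]=\{1,\dots,m\}$ whose underlying undirected graph is a tree and which has a unique source node. A trek between $i$ and $j$ is a pair $T=\{P,Q\}$ of directed paths (length zero allowed) with a common starting node, $P$ ending at $i$ and $Q$ ending at $j$; its length is $|T|=|P|+|Q|$ (number of edges). Under the constant coloring $c^*$ all vertices share one parameter $\omega$ and all edges share one parameter $\lambda$, and the trek polynomial is $p_{i,j}=\sum_T\omega\lambda^{|T|}$, summed over all treks $T$ between $i$ and $j$ in $\mathcal G$. The variety $\mathcal V_{\varphi_{\mathcal G,c^*}}\subseteq\mathbb R^{\binom{m+1}{2}}$ is the Zariski closure of the image of $\varphi_{\mathcal G,c^*}:\mathbb R^2\to\mathbb R^{\binom{m+1}{2}}$, $(\omega,\lambda)\mapsto(\sigma_{ij})_{1\le i\le j\le m}$ with $\sigma_{ij}=p_{i,j}(\omega,\lambda)$, and $I_{\varphi_{\mathcal G,c^*}}\subseteq\mathbb R[\sigma_{ij}:1\le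 i\le j\le m]$ is its vanishing ideal.
   Formalization: The case m = 2 is excluded, since there the claim fails: for 1→2 and 2→1 the coordinates ω, ωλ, ω+ωλ² are linearly independent, so no nonzero linear form vanishes on either variety, yet the trees differ. *)

theory Defs
  imports "Graph_Theory.Graph_Theory" "HOL-Library.Poly_Mapping" "HOL-Library.FuncSet" Complex_Main
begin

text \<open>In the symmetrisation of a digraph, traversing one edge forth and back is a
  library \<open>cycle\<close> of length 2. For a loop-free digraph, the cycles of the underlying
  undirected graph are those of length at least 3. (The library's \<open>tree\<close> forbids only
  directed cycles and is therefore not used.)\<close>

definition underlying_tree :: "'a pair_pre_digraph \<Rightarrow> bool" where
  "underlying_tree G \<longleftrightarrow> Digraph_Component.connected (with_proj G) \<and>
    \<not> (\<exists>p. pre_digraph.cycle (with_proj (mk_symmetric (with_proj G))) p \<and> 3 \<le> length p)"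

definition directed_tree :: "nat \<Rightarrow> nat pair_pre_digraph \<Rightarrow> bool" where
  "directed_tree m G \<longleftrightarrow> pair_digraph G \<and> pverts G = {1..m} \<and> acyclic (parcs G) \<and>
    underlying_tree G \<and> (\<exists>!v. v \<in> pverts G \<and> in_degree (with_proj G) v = 0)"

text \<open>Paths are nonempty vertex lists; the singleton list is the path of length zero.
  A trek between \<open>i\<close> and \<open>j\<close> is recorded as the pair of its leg ending at \<open>i\<close> and its
  leg ending at \<open>j\<close>. (In a directed tree both legs of a trek from \<open>i\<close> to itself coincide,
  so ordered and unordered pairs give the same sum.)\<close>

definition treks :: "'a pair_pre_digraph \<Rightarrow> 'a \<Rightarrow> 'a \<Rightarrow> ('a vwalk \<times> 'a vwalk) set" where
  "treks G i j = {(P, Q). vpath P (with_proj G) \<and> vpath Q (with_proj G) \<and>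
    hd P = hd Q \<and> last P = i \<and> last Q = j}"

definition trek_length :: "'a vwalk \<times> 'a vwalk \<Rightarrow> nat" where
  "trek_length T = vwalk_length (fst T) + vwalk_length (snd T)"

text \<open>The trek polynomial for the constant coloring, as a function of the single vertex
  parameter \<open>w\<close> and the single edge parameter \<open>l\<close>.\<close>

definition trek_poly :: "'a pair_pre_digraph \<Rightarrow> 'a \<Rightarrow> 'a \<Rightarrow> real \<Rightarrow> real \<Rightarrow> real" where
  "trek_poly G i j w l = (\<Sum>T\<in>treks G i j. w * l ^ trek_length T)"

text \<open>The coordinate space with coordinates indexed by \<open>S\<close> is \<open>S \<rightarrow>\<^sub>E UNIV\<close>.\<close>

definition sym_index :: "nat \<Rightarrow> (nat \<times> nat) set" where
  "sym_index m = {(i, j). 1 \<le> i \<and> i \<le> j \<and> j \<le> m}"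

definition param_map :: "nat \<Rightarrow> nat pair_pre_digraph \<Rightarrow> real \<times> real \<Rightarrow> nat \<times> nat \<Rightarrow> real" where
  "param_map m G = (\<lambda>(w, l). restrict (\<lambda>(i, j). trek_poly G i j w l) (sym_index m))"

text \<open>Multivariate polynomials over the reals are finitely supported maps from monomials
  (finitely supported exponent vectors) to coefficients.\<close>

type_synonym 'v rpoly = "('v \<Rightarrow>\<^sub>0 nat) \<Rightarrow>\<^sub>0 real"

definition poly_ring :: "'v set \<Rightarrow> 'v rpoly set" where
  "poly_ring S = {f. \<forall>t\<in>Poly_Mapping.keys f. Poly_Mapping.keys t \<subseteq> S}"

definition rpoly_eval :: "('v \<Rightarrow> real) \<Rightarrow> 'v rpoly \<Rightarrow> real" where
  "rpoly_eval x f = (\<Sum>t\<in>Poly_Mapping.keys f. Poly_Mapping.lookup f t *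
    (\<Prod>v\<in>Poly_Mapping.keys t. x v ^ Poly_Mapping.lookup t v))"

definition zariski_closed :: "'v set \<Rightarrow> ('v \<Rightarrow> real) set \<Rightarrow> bool" where
  "zariski_closed S Z \<longleftrightarrow>
    (\<exists>F \<subseteq> poly_ring S. Z = {x \<in> S \<rightarrow>\<^sub>E UNIV. \<forall>f\<in>F. rpoly_eval x f = 0})"

definition zariski_closure :: "'v set \<Rightarrow> ('v \<Rightarrow> real) set \<Rightarrow> ('v \<Rightarrow> real) set" where
  "zariski_closure S A = zariski_closed S hull A"

definition vanishing_ideal :: "'v set \<Rightarrow> ('v \<Rightarrow> real) set \<Rightarrow> 'v rpoly set" where
  "vanishing_ideal S A = {f \<in> poly_ring S. \<forall>x\<in>A. rpoly_eval x f = 0}"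

definition degree_component :: "nat \<Rightarrow> 'v rpoly set \<Rightarrow> 'v rpoly set" where
  "degree_component d I =
    {f \<in> I. \<forall>t\<in>Poly_Mapping.keys f. (\<Sum>v\<in>Poly_Mapping.keys t. Poly_Mapping.lookup t v) = d}"

definition tree_variety :: "nat \<Rightarrow> nat pair_pre_digraph \<Rightarrow> (nat \<times> nat \<Rightarrow> real) set" where
  "tree_variety m G = zariski_closure (sym_index m) (range (param_map m G))"

text \<open>For \<open>m = 2\<close> the two directed trees have different ideals, but neither ideal contains a
  nonzero linear form: \<open>w\<close>, \<open>w * l\<close> and \<open>w + w * l\<^sup>2\<close> are linearly independent. Recovering
  the tree from the degree 1 component therefore requires \<open>m \<noteq> 2\<close>.\<close>

definition tree_ideal :: "nat \<Rightarrow> nat pair_pre_digraph \<Rightarrow> (nat \<times> nat) rpoly set" where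
  "tree_ideal m G = vanishing_ideal (sym_index m) (tree_variety m G)"

end

theory Submission
  imports Defs
begin

text \<open>Write \<open>d\<close> for the depth below the root. A trek between \<open>i\<close> and \<open>j\<close> is given by a common
  ancestor, so \<open>\<sigma>(i, j) = \<omega> \<cdot> (\<Sum>k<n. \<lambda> ^ (d(i) + d(j) - 2 k))\<close> with \<open>n\<close> the number of common ancestors.
  Only relations of the form \<open>\<sigma>(a, b) + \<sigma>(c, d) = \<sigma>(e, f)\<close> are needed. For a grandparent \<open>g\<close>, parent
  \<open>p\<close> and child \<open>v\<close>, as well as for siblings \<open>g, v\<close> with \<open>p = g\<close>, one has
  \<open>\<sigma>(g, v) + \<sigma>(r, r) = \<sigma>(p, p)\<close> where \<open>r\<close> is the root. Read in the other tree at \<open>\<lambda> = 1\<close>, where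
  \<open>\<sigma>\<close> counts treks, such relations force the roots to agree; read at \<open>\<lambda> = 2\<close>, they force equal
  depths, by induction along the tree. Finally, if \<open>p\<close> is the parent of \<open>v\<close> and \<open>q\<close> another vertex on the
  level of \<open>p\<close>, then \<open>\<sigma>(q, v) + \<sigma>(x, y) = \<sigma>(p, v)\<close> for some arc \<open>(x, y)\<close>; hence \<open>q\<close> cannot be the
  parent of \<open>v\<close> in the other tree, where a parent maximises the number of treks to \<open>v\<close> on its level.\<close>

section \<open>Rooted trees\<close>

locale rooted_tree =
  fixes V :: "'a set" and E :: "'a rel" and r :: 'a
  assumes finite_verts: "finite V"
    and arcs_subset: "E \<subseteq> V \<times> V"
    and acyclic_arcs: "acyclic E"
    and root_in_verts: "r \<in> V"
    and root_source: "(u, r) \<notin> E"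
    and ex_parent: "v \<in> V \<Longrightarrow> v \<noteq> r \<Longrightarrow> \<exists>u. (u, v) \<in> E"
    and parent_unique: "(u, v) \<in> E \<Longrightarrow> (u', v) \<in> E \<Longrightarrow> u = u'"
begin

definition anc :: "'a \<Rightarrow> 'a set" where
  "anc v = {a. (a, v) \<in> E\<^sup>*}"

text \<open>Parents are unique, so on vertices this is the distance from the root.\<close>

definition depth :: "'a \<Rightarrow> nat" where
  "depth v = card {a. (a, v) \<in> E\<^sup>+}"

definition com :: "'a \<Rightarrow> 'a \<Rightarrow> nat" where
  "com i j = card (anc i \<inter> anc j)"

text \<open>The trek polynomial at vertex parameter 1, with \<open>k\<close> the depth of the top of
  the trek. As \<open>com i j\<close> is at most \<open>Suc (depth i)\<close> and at most
  \<open>Suc (depth j)\<close>, the subtraction never truncates.\<close>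

definition sig :: "'a \<Rightarrow> 'a \<Rightarrow> real \<Rightarrow> real" where
  "sig i j l = (\<Sum>k<com i j. l ^ (depth i + depth j - 2 * k))"

section \<open>Ancestors and depth\<close>

lemma arc_verts: "(u, v) \<in> E \<Longrightarrow> u \<in> V" "(u, v) \<in> E \<Longrightarrow> v \<in> V"
  using arcs_subset by auto

lemma trancl_subset: "E\<^sup>+ \<subseteq> V \<times> V"
  using arcs_subset by (rule trancl_subset_Sigma)

lemma anc_eq: "anc v = insert v {a. (a, v) \<in> E\<^sup>+}"
  by (auto simp: anc_def rtrancl_eq_or_trancl)

lemma finite_proper_anc: "finite {a. (a, v) \<in> E\<^sup>+}"
  by (rule finite_subset[OF _ finite_verts]) (use trancl_subset in auto)

lemma finite_anc [simp]: "finite (anc v)"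
  by (simp add: anc_eq finite_proper_anc)

lemma anc_subset: "v \<in> V \<Longrightarrow> anc v \<subseteq> V"
  using trancl_subset by (auto simp: anc_eq)

lemma self_in_anc [simp]: "v \<in> anc v"
  by (simp add: anc_def)

lemma anc_mono: "a \<in> anc v \<Longrightarrow> anc a \<subseteq> anc v"
  by (auto simp: anc_def)

lemma card_anc: "card (anc v) = Suc (depth v)"
  using acyclic_arcs finite_proper_anc by (simp add: anc_eq depth_def acyclic_def)

lemma proper_anc_arc:
  assumes "(u, v) \<in> E"
  shows "{a. (a, v) \<in> E\<^sup>+} = anc u"
proof (intro set_eqI iffI)
  fix a assume "a \<in> {a. (a, v) \<in> E\<^sup>+}"
  then obtain w where "(a, w) \<in> E\<^sup>*" "(w, v) \<in> E"
    by (auto dest: tranclD2)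
  then show "a \<in> anc u" using parent_unique[OF assms] by (auto simp: anc_def)
next
  fix a assume "a \<in> anc u"
  then show "a \<in> {a. (a, v) \<in> E\<^sup>+}" using assms by (auto simp: anc_def)
qed

lemma anc_arc: "(u, v) \<in> E \<Longrightarrow> anc v = insert v (anc u)"
  using proper_anc_arc by (simp add: anc_eq[of v])

lemma depth_arc: "(u, v) \<in> E \<Longrightarrow> depth v = Suc (depth u)"
  using proper_anc_arc card_anc by (simp add: depth_def[of v])

lemma no_proper_anc_root: "(a, r) \<notin> E\<^sup>+"
  using root_source by (auto dest: tranclD2)

lemma depth_root [simp]: "depth r = 0"
  using no_proper_anc_root by (simp add: depth_def)

lemma anc_root: "anc r = {r}"
  using no_proper_anc_root by (simp add: anc_eq)

lemma verts_induct [consumes 1, case_names root child]: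
  assumes "v \<in> V" and "P r" and "\<And>u v. (u, v) \<in> E \<Longrightarrow> P u \<Longrightarrow> P v"
  shows "P v"
  using assms(1)
proof (induction "depth v" arbitrary: v rule: less_induct)
  case less
  show ?case
  proof (cases "v = r")
    case False
    then obtain u where u: "(u, v) \<in> E" using ex_parent less.prems by blast
    then have "P u" using less arc_verts depth_arc by simp
    then show ?thesis using u assms(3) by blast
  qed (use assms(2) in simp)
qed

lemma depth_eq_0_iff: "v \<in> V \<Longrightarrow> depth v = 0 \<longleftrightarrow> v = r"
  using ex_parent[of v] depth_arc by fastforce

lemma root_in_anc: "v \<in> V \<Longrightarrow> r \<in> anc v"
  by (induction rule: verts_induct) (auto simp: anc_arc)

lemma depth_anc_le: "a \<in> anc v \<Longrightarrow> depth a \<le> depth v"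
  using card_mono[OF finite_anc anc_mono, of a v] by (simp add: card_anc)

text \<open>Passing from a parent to a child adds one ancestor, the child itself, one level
  deeper.\<close>

lemma depth_anc:
  assumes "v \<in> V"
  shows "inj_on depth (anc v) \<and> depth ` anc v = {..depth v}"
  using assms
proof (induction rule: verts_induct)
  case (child u v)
  have dv: "depth v = Suc (depth u)" using child by (simp add: depth_arc)
  then have "depth v \<notin> depth ` anc u" using child by simp
  then have "depth v \<notin> depth ` (anc u - {v})" by blast
  then show ?case using child dv by (simp add: anc_arc atMost_Suc)
qed (simp add: anc_root)

lemma ex_anc_depth:
  assumes "v \<in> V" "k \<le> depth v"
  shows "\<exists>a\<in>anc v. depth a = k"
proof -
  have "k \<in> depth ` anc v" using depth_anc[OF assms(1)] assms(2) by simp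
  then show ?thesis by auto
qed

lemma ex_parent_depth:
  assumes "v \<in> V" "0 < depth v"
  shows "\<exists>u. (u, v) \<in> E"
  using assms ex_parent[of v] by fastforce

lemma anc_depth_eq:
  assumes "v \<in> V" "a \<in> anc v" "depth a = depth v"
  shows "a = v"
  using depth_anc[OF assms(1)] assms(2,3) by (auto dest: inj_onD)

text \<open>Common ancestors are closed under taking ancestors, so their depths form an initial
  segment.\<close>

lemma bij_betw_depth_common_anc:
  assumes "i \<in> V"
  shows "bij_betw depth (anc i \<inter> anc j) {..<com i j}"
proof -
  let ?S = "depth ` (anc i \<inter> anc j)"
  have inj: "inj_on depth (anc i \<inter> anc j)"
    using depth_anc[OF assms] by (auto intro: inj_on_subset)
  have card: "card ?S = com i j"
    using inj by (simp add: card_image com_def)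
  \<comment> \<open>A depth \<open>n\<close> in \<open>?S\<close> brings all of \<open>{..n}\<close>
    along, which forces \<open>n < card ?S\<close>.\<close>
  have "?S \<subseteq> {..<card ?S}"
  proof
    fix n assume "n \<in> ?S"
    then obtain a where a: "a \<in> anc i" "a \<in> anc j" "n = depth a" by auto
    then have "a \<in> V" using anc_subset assms by auto
    then have "{..n} = depth ` anc a" using depth_anc a by simp
    also have "\<dots> \<subseteq> ?S" using a anc_mono by blast
    finally have "card {..n} \<le> card ?S" by (intro card_mono) auto
    then show "n \<in> {..<card ?S}" by simp
  qed
  then have "?S = {..<card ?S}" by (intro card_subset_eq) auto
  with inj card show ?thesis by (simp add: bij_betw_def)
qed

section \<open>Common ancestors and covariances\<close>

lemma com_commute: "com i j = com j i"
  by (simp add: com_def Int_commute)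

lemma sig_commute: "sig i j l = sig j i l"
  by (simp add: sig_def com_commute add.commute)

lemma com_pos:
  assumes "i \<in> V" "j \<in> V"
  shows "0 < com i j"
  using root_in_anc[OF assms(1)] root_in_anc[OF assms(2)] by (auto simp: com_def card_gt_0_iff)

lemma com_anc: "a \<in> anc v \<Longrightarrow> com a v = Suc (depth a)"
  using anc_mono[of a v] by (simp add: com_def Int_absorb2 card_anc)

lemma com_self [simp]: "com v v = Suc (depth v)"
  by (simp add: com_anc)

lemma com_le: "com q v \<le> Suc (depth q)"
  unfolding com_def card_anc[symmetric] by (rule card_mono) auto

lemma com_eq_imp_anc:
  assumes "com q v = Suc (depth q)"
  shows "q \<in> anc v"
proof -
  have "anc q \<inter> anc v = anc q"
    using assms by (intro card_subset_eq) (auto simp: com_def card_anc)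
  then show ?thesis using self_in_anc[of q] by blast
qed

lemma sig_one [simp]: "sig i j 1 = real (com i j)"
  by (simp add: sig_def)

lemma sig_root [simp]: "sig r r l = 1"
  by (simp add: sig_def)

text \<open>Both sides are \<open>\<Sum>k\<le>depth a. l ^ (2 * depth a - 2 * k)\<close>; the variance of the root is the
  summand for \<open>k = depth a\<close>.\<close>

lemma sig_add_root:
  assumes "depth i + depth j = 2 * depth a" "com i j = depth a"
  shows "sig i j l + sig r r l = sig a a l"
  using assms by (simp add: sig_def mult_2)

text \<open>Hypotheses of \<open>sig_add_root\<close> for \<open>a = p\<close>: the common ancestors
  of \<open>g\<close> and \<open>v\<close> are the ancestors of \<open>g\<close>, one on each level
  above \<open>p\<close>.\<close>

lemma grandparent_top:
  assumes "(g, p) \<in> E" "(p, v) \<in> E"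
  shows "depth g + depth v = 2 * depth p" "com g v = depth p"
  using assms by (simp_all add: depth_arc com_anc anc_arc)

lemma siblings_top:
  assumes "(p, i) \<in> E" "(p, j) \<in> E" "i \<noteq> j"
  shows "depth i + depth j = 2 * depth i" "com i j = depth i"
proof -
  have "anc i \<inter> anc j = anc p"
    using assms depth_arc depth_anc_le[of i p] depth_anc_le[of j p] by (auto simp: anc_arc)
  then show "com i j = depth i"
    using assms by (simp add: com_def card_anc depth_arc)
  show "depth i + depth j = 2 * depth i"
    using assms by (simp add: depth_arc)
qed

text \<open>Only the depth of \<open>a\<close> matters, so any path of two arcs with its middle
  vertex on that level will do. An ancestor of \<open>b\<close> one level below \<open>a\<close>
  ends such a path.\<close>

lemma inner_top:
  assumes "a \<in> V" "a \<noteq> r" "b \<in> V" "depth a < depth b"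
  shows "\<exists>i\<in>V. \<exists>j\<in>V. depth i + depth j = 2 * depth a \<and> com i j = depth a"
proof -
  obtain v where v: "v \<in> V" "depth v = Suc (depth a)"
    using ex_anc_depth[of b "Suc (depth a)"] assms anc_subset by auto
  obtain p where p: "(p, v) \<in> E" using ex_parent_depth[of v] v by auto
  then have dp: "depth p = depth a" using v depth_arc by simp
  obtain g where g: "(g, p) \<in> E"
    using ex_parent_depth[of p] dp depth_eq_0_iff[of a] assms arc_verts(1)[OF p] by auto
  show ?thesis
    using grandparent_top[OF g p] dp arc_verts(1)[OF g] v(1) by auto
qed

text \<open>Two non-root vertices either share their parent, or one of their parents is not the root
  and has a parent itself.\<close>

lemma ex_top:
  assumes "3 \<le> card V"
  shows "\<exists>i\<in>V. \<exists>j\<in>V. \<exists>a\<in>V. depth i + depth j = 2 * depth a \<and> com i j = depth a"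
proof -
  have "2 \<le> card (V - {r})"
    using assms finite_verts root_in_verts by simp
  then obtain S where "S \<subseteq> V - {r}" "card S = 2"
    by (rule obtain_subset_with_card_n) blast
  then obtain i j where ij: "i \<in> V" "j \<in> V" "i \<noteq> r" "j \<noteq> r" "i \<noteq> j"
    by (auto simp: card_2_iff)
  obtain p q where pq: "(p, i) \<in> E" "(q, j) \<in> E" using ij ex_parent by metis
  show ?thesis
  proof (cases "p = q")
    case True
    then show ?thesis using siblings_top[of p i j] pq ij by blast
  next
    case False
    have "\<exists>x y z. (x, y) \<in> E \<and> (y, z) \<in> E"
    proof (cases "p = r")
      case True
      then show ?thesis using False ex_parent[of q] arc_verts pq by blast
    next
      case False
      then show ?thesis using ex_parent[of p] arc_verts pq by blast
    qed
    then obtain x y z where "(x, y) \<in> E" "(y, z) \<in> E" by blast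
    then show ?thesis using grandparent_top[of x y z] arc_verts by metis
  qed
qed

text \<open>The covariance of \<open>v\<close> with its parent \<open>p\<close> contains all odd powers below \<open>2 * depth v\<close>. For
  another vertex \<open>q\<close> on the level of \<open>p\<close> the lowest powers are missing; they form the covariance
  along the arc that leaves the ancestor of \<open>v\<close> at depth \<open>depth p - com q v\<close>.\<close>

lemma sig_parent_level:
  assumes "(p, v) \<in> E" "q \<in> V" "depth q = depth p" "q \<noteq> p"
  shows "\<exists>x\<in>V. \<exists>y\<in>V. \<forall>l. sig q v l + sig x y l = sig p v l"
proof -
  have v: "v \<in> V" using assms arc_verts by blast
  have dv: "depth v = Suc (depth p)" using assms depth_arc by blast
  have "q \<notin> anc v"
  proof
    assume "q \<in> anc v"
    then have "q \<in> anc p" using anc_arc[OF assms(1)] dv assms(3) by auto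
    then show False using anc_depth_eq assms arc_verts by blast
  qed
  then have c: "com q v \<le> depth p"
    using com_le[of q v] com_eq_imp_anc[of q v] assms(3) by linarith
  define m where "m = depth v - com q v"
  have m: "0 < m" "m \<le> depth v" "com q v + m = Suc (depth p)" using c dv by (auto simp: m_def)
  obtain y where y: "y \<in> anc v" "depth y = m" using ex_anc_depth[OF v m(2)] by blast
  then have yV: "y \<in> V" using anc_subset v by blast
  obtain x where x: "(x, y) \<in> E" using ex_parent_depth[OF yV] m y by auto
  have xm: "Suc (depth x) = m" using depth_arc[OF x] y by simp
  have comxy: "com x y = m" using com_anc[of x y] anc_arc[OF x] xm by simp
  have compv: "com p v = Suc (depth p)" using com_anc[of p v] anc_arc[OF assms(1)] by simp
  have split: "(\<Sum>k<c + n. f k) = (\<Sum>k<c. f k) + (\<Sum>k<n. f (c + k))" for c n and f :: "nat \<Rightarrow> real"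
    by (induction n) simp_all
  have exponent: "depth p + depth v - 2 * (com q v + k) = depth x + depth y - 2 * k" for k
    using xm y(2) m(3) dv by simp
  have "sig q v l + sig x y l = sig p v l" for l
  proof -
    have "sig p v l = (\<Sum>k<com q v + m. l ^ (depth p + depth v - 2 * k))"
      by (simp add: sig_def compv m(3))
    also have "\<dots> = sig q v l + (\<Sum>k<m. l ^ (depth p + depth v - 2 * (com q v + k)))"
      by (simp add: split sig_def assms(3))
    also have "(\<Sum>k<m. l ^ (depth p + depth v - 2 * (com q v + k))) = sig x y l"
      by (simp only: sig_def comxy exponent)
    finally show ?thesis by simp
  qed
  then show ?thesis using yV arc_verts(1)[OF x] by blast
qed

end

section \<open>Two trees with the same linear relations\<close>

text \<open>The bound \<open>2 * n \<le> y\<close> keeps the exponents on the right from being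
  truncated.\<close>

lemma sum_power_less:
  assumes "0 < n" "x < y" "2 * n \<le> y"
  shows "(\<Sum>k<n. 2 ^ (x - 2 * k)) < (\<Sum>k<n. (2::real) ^ (y - 2 * k))"
  using assms by (intro sum_strict_mono power_strict_increasing) auto

text \<open>The vertices in \<open>relations\<close> may coincide, so variances are covered as
  well.\<close>

locale related_trees =
  G: rooted_tree V E r + H: rooted_tree V E' r'
  for V :: "'a set" and E E' :: "'a rel" and r r' :: 'a +
  assumes relations: "{a, b, c, d, e, f} \<subseteq> V \<Longrightarrow>
    (\<forall>l. G.sig a b l + G.sig c d l = G.sig e f l) \<longleftrightarrow>
    (\<forall>l. H.sig a b l + H.sig c d l = H.sig e f l)"
begin

lemma swapped: "related_trees V E' E r' r"
  by (intro related_trees.intro related_trees_axioms.intro G.rooted_tree_axioms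
      H.rooted_tree_axioms relations[symmetric])

text \<open>Here \<open>r\<close> is the root of the first tree only. Its position in the second
  tree is still open, so \<open>H.sig r r l\<close> cannot yet be replaced by 1.\<close>

lemma top_relation:
  assumes "i \<in> V" "j \<in> V" "a \<in> V" "G.depth i + G.depth j = 2 * G.depth a" "G.com i j = G.depth a"
  shows "H.sig i j l + H.sig r r l = H.sig a a l"
proof -
  have "{i, j, r, r, a, a} \<subseteq> V" using assms(1-3) G.root_in_verts by blast
  from relations[OF this] G.sig_add_root[OF assms(4,5)] show ?thesis by blast
qed

lemma top_com:
  assumes "i \<in> V" "j \<in> V" "a \<in> V" "G.depth i + G.depth j = 2 * G.depth a" "G.com i j = G.depth a"
  shows "H.com i j + H.depth r = H.depth a"
  using top_relation[OF assms, of 1] by simp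

text \<open>The count \<open>H.com i j\<close> in \<open>top_com\<close> is positive. So
  \<open>r\<close> is not on the deepest level of the second tree.\<close>

lemma ex_deeper_than_root:
  assumes "3 \<le> card V"
  shows "\<exists>a\<in>V. H.depth r < H.depth a"
proof -
  obtain i j a where ija: "i \<in> V" "j \<in> V" "a \<in> V"
    "G.depth i + G.depth j = 2 * G.depth a" "G.com i j = G.depth a"
    using G.ex_top[OF assms] by blast
  then show ?thesis using top_com[OF ija] H.com_pos[of i j] by force
qed

text \<open>Otherwise \<open>r'\<close> is neither the root of the first tree nor on its deepest
  level, and can serve as \<open>a\<close> in \<open>top_com\<close>. Its depth 0 in the second tree
  leaves no room for the positive \<open>H.com i j\<close>.\<close>

lemma root_eq:
  assumes "3 \<le> card V"
  shows "r' = r"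
proof (rule ccontr)
  assume ne: "r' \<noteq> r"
  obtain b where b: "b \<in> V" "G.depth r' < G.depth b"
    using related_trees.ex_deeper_than_root[OF swapped assms] by blast
  obtain i j where ij: "i \<in> V" "j \<in> V"
    "G.depth i + G.depth j = 2 * G.depth r'" "G.com i j = G.depth r'"
    using G.inner_top[OF H.root_in_verts ne b] by blast
  then show False
    using top_com[OF ij(1,2) H.root_in_verts ij(3,4)] H.com_pos[OF ij(1,2)] by simp
qed

lemma depth_level_1:
  assumes "3 \<le> card V" "(r, v) \<in> E"
  shows "H.depth v = 1"
proof -
  have v: "v \<in> V" "G.depth v = 1"
    using assms(2) G.arc_verts G.depth_arc by auto
  have r: "H.depth r = 0" using root_eq[OF assms(1)] H.depth_root by simp
  show ?thesis
  proof (cases "\<exists>u\<in>V. G.depth u = 2")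
    case True
    then obtain u where u: "u \<in> V" "G.depth u = 2" by blast
    \<comment> \<open>The vertex \<open>v\<close> need not be the parent of \<open>u\<close>, since
      only its depth enters the relation.\<close>
    have "G.com r u = G.depth v"
      using G.com_anc[OF G.root_in_anc[OF u(1)]] v by simp
    then have "H.com r u = H.depth v"
      using top_com[OF G.root_in_verts u(1) v(1)] u v r by simp
    then show ?thesis
      using H.com_anc[of r u] H.root_in_anc[OF u(1)] root_eq[OF assms(1)] r by simp
  next
    case False
    \<comment> \<open>The first tree is a star, so all non-root vertices are siblings.\<close>
    have low: "G.depth u \<le> 1" if "u \<in> V" for u
    proof (rule ccontr)
      assume "\<not> G.depth u \<le> 1"
      then show False
        using G.ex_anc_depth[OF that, of 2] G.anc_subset[OF that] False by auto
    qed
    have "v \<noteq> r" using v by auto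
    then have "0 < H.depth v"
      using H.depth_eq_0_iff[OF v(1)] root_eq[OF assms(1)] by simp
    then obtain w where "w \<in> H.anc v" and dw: "H.depth w = 1"
      using H.ex_anc_depth[OF v(1), of 1] by auto
    then have w: "w \<in> V" "w \<noteq> r" using H.anc_subset[OF v(1)] r by auto
    obtain q where q: "(q, w) \<in> E" using G.ex_parent[OF w] by blast
    have "G.depth q = 0" using G.depth_arc[OF q] low[OF w(1)] by simp
    then have rw: "(r, w) \<in> E" using G.depth_eq_0_iff G.arc_verts(1)[OF q] q by simp
    show ?thesis
    proof (cases "w = v")
      case False
      \<comment> \<open>Either sibling can serve as \<open>a\<close>, so both have the same depth in
        the second tree.\<close>
      note vw = G.siblings_top[OF assms(2) rw False[symmetric]]
      have "G.depth w = G.depth v" using v(2) G.depth_arc[OF rw] by simp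
      then have "H.depth v = H.depth w"
        using top_com[OF v(1) w(1) v(1) vw] top_com[OF v(1) w(1) w(1)] vw by simp
      then show ?thesis using dw by simp
    qed (use dw in simp)
  qed
qed

text \<open>With \<open>g\<close> the grandparent of \<open>v\<close>, the value at 1 yields the
  number of terms of \<open>H.sig g v\<close>; the value at 2 then yields the sum of the two
  depths.\<close>

lemma depth_eq:
  assumes "3 \<le> card V" "v \<in> V"
  shows "H.depth v = G.depth v"
  using assms(2)
proof (induction "G.depth v" arbitrary: v rule: less_induct)
  case less
  have r: "H.depth r = 0" using root_eq[OF assms(1)] H.depth_root by simp
  show ?case
  proof (cases "v = r")
    case False
    then obtain p where p: "(p, v) \<in> E" using G.ex_parent less.prems by blast
    show ?thesis
    proof (cases "p = r")
      case True
      then show ?thesis using depth_level_1[OF assms(1)] p G.depth_arc by simp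
    next
      case False
      have pV: "p \<in> V" using p G.arc_verts by blast
      obtain g where g: "(g, p) \<in> E" using G.ex_parent pV False by blast
      have gV: "g \<in> V" using g G.arc_verts by blast
      have d: "G.depth v = Suc (G.depth p)" "G.depth p = Suc (G.depth g)"
        using p g G.depth_arc by auto
      have dp: "H.depth p = G.depth p" using less.hyps[OF _ pV] d by simp
      have dg: "H.depth g = G.depth g" using less.hyps[OF _ gV] d by simp
      define n where "n = Suc (G.depth g)"
      note top = gV less.prems pV G.grandparent_top[OF g p]
      have com: "H.com g v = n" using top_com[OF top] dp d r by (simp add: n_def)
      then have "g \<in> H.anc v" using dg by (intro H.com_eq_imp_anc) (simp add: n_def)
      \<comment> \<open>The variance 1 of the root cancels the last summand \<open>2 ^ 0\<close> of
        \<open>H.sig p p 2\<close>.\<close>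
      then have "(\<Sum>k<n. (2::real) ^ (H.depth g + H.depth v - 2 * k)) = (\<Sum>k<n. 2 ^ (2 * n - 2 * k))"
        using top_relation[OF top, of 2] com dp d r root_eq[OF assms(1)] H.sig_root
        by (simp add: H.sig_def n_def mult_2)
      \<comment> \<open>Whichever side were larger, it would be at least \<open>2 * n\<close>, as
        \<open>sum_power_less\<close> demands.\<close>
      then have "H.depth g + H.depth v = 2 * n"
        using sum_power_less[of n "H.depth g + H.depth v" "2 * n"]
          sum_power_less[of n "2 * n" "H.depth g + H.depth v"]
        by (force simp: n_def)
      then show ?thesis using dg d by (simp add: n_def)
    qed
  qed (use r in simp)
qed

lemma parent_eq:
  assumes "3 \<le> card V" "(p, v) \<in> E" "(q, v) \<in> E'"
  shows "p = q"
proof (rule ccontr)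
  assume "p \<noteq> q"
  have pV: "p \<in> V" and qV: "q \<in> V" and vV: "v \<in> V"
    using assms G.arc_verts H.arc_verts by blast+
  \<comment> \<open>Each of \<open>p\<close> and \<open>q\<close> lies one level above
    \<open>v\<close> in its own tree.\<close>
  have d: "G.depth q = G.depth p"
    using depth_eq[OF assms(1)] pV qV vV G.depth_arc[OF assms(2)] H.depth_arc[OF assms(3)] by simp
  obtain x y where xy: "x \<in> V" "y \<in> V" "\<forall>l. G.sig q v l + G.sig x y l = G.sig p v l"
    using G.sig_parent_level[OF assms(2) qV d] \<open>p \<noteq> q\<close> by blast
  then have "\<forall>l. H.sig q v l + H.sig x y l = H.sig p v l"
    using relations[of q v x y p v] pV qV vV by simp
  then have "H.com q v + H.com x y = H.com p v"
    using H.sig_one by (metis of_nat_add of_nat_eq_iff)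
  moreover have "H.com q v = Suc (H.depth q)"
    using H.anc_arc[OF assms(3)] by (intro H.com_anc) simp
  moreover have "H.com p v \<le> Suc (H.depth p)" by (rule H.com_le)
  moreover have "H.depth p = H.depth q"
    using d depth_eq[OF assms(1)] pV qV by simp
  ultimately show False using H.com_pos[OF xy(1,2)] by simp
qed

lemma arcs_eq:
  assumes "3 \<le> card V"
  shows "E' = E"
proof -
  have "(u, v) \<in> E' \<longleftrightarrow> (u, v) \<in> E" for u v
    using parent_eq[OF assms, of _ v] root_eq[OF assms] G.ex_parent[of v] H.ex_parent[of v]
      G.root_source H.root_source G.arc_verts[of u v] H.arc_verts[of u v] by metis
  then show ?thesis by auto
qed

end

section \<open>Directed trees and their trek polynomials\<close>

text \<open>Two distinct parents of \<open>v\<close> would be joined by an undirected path through \<open>x\<close>; it avoids \<open>v\<close>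
  by acyclicity, so it closes up to a cycle at \<open>v\<close>.\<close>

lemma unique_parent:
  assumes "pair_digraph G" "acyclic (parcs G)"
    and no_cycle: "\<not> (\<exists>p. pre_digraph.cycle (with_proj (mk_symmetric (with_proj G))) p \<and> 3 \<le> length p)"
    and reach: "(x, u) \<in> (parcs G)\<^sup>*" "(x, u') \<in> (parcs G)\<^sup>*"
    and arcs: "(u, v) \<in> parcs G" "(u', v) \<in> parcs G"
  shows "u = u'"
proof (rule ccontr)
  assume ne: "u \<noteq> u'"
  interpret G: pair_digraph G by fact
  let ?M = "mk_symmetric (with_proj G)"
  interpret M: pair_wf_digraph ?M by (rule G.wellformed_mk_symmetric)
  have symM: "(b, a) \<in> parcs ?M" if "(a, b) \<in> parcs ?M" for a b
    using that unfolding parcs_mk_symmetric by fastforce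
  have arcM: "(a, b) \<in> parcs ?M" if "(a, b) \<in> parcs G" for a b
    unfolding parcs_mk_symmetric using that by (intro UN_I[of "(a, b)"]) simp_all
  \<comment> \<open>Undirected steps that avoid \<open>v\<close>; the connection from
    \<open>u\<close> to \<open>u'\<close> via \<open>x\<close> is built inside
    \<open>R\<close>.\<close>
  define R where "R = {(a, b) \<in> parcs ?M. a \<noteq> v \<and> b \<noteq> v}"
  have symR: "sym R" using symM by (auto simp: R_def intro: symI)
  \<comment> \<open>If \<open>a\<close> were \<open>v\<close>, the arc into \<open>v\<close> would
    close a directed cycle.\<close>
  have not_v: "a \<noteq> v" if "(a, b) \<in> (parcs G)\<^sup>*" "(b, v) \<in> parcs G" for a b
    using that assms(2) by (metis acyclic_def rtrancl_into_trancl1)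
  have in_R: "(a, b) \<in> R\<^sup>*" if "(a, b) \<in> (parcs G)\<^sup>*" "(b, v) \<in> parcs G" for a b
    using that(1)
  proof (induction rule: converse_rtrancl_induct)
    case (step y z)
    then have "(y, b) \<in> (parcs G)\<^sup>*" by (simp add: converse_rtrancl_into_rtrancl)
    with step have "(y, z) \<in> R"
      using not_v[of y b] not_v[of z b] that(2) arcM by (auto simp: R_def)
    then show ?case using step by auto
  qed simp
  have "(x, u) \<in> R\<^sup>*" "(x, u') \<in> R\<^sup>*" using in_R reach arcs by blast+
  moreover from this(1) have "(u, x) \<in> R\<^sup>*" using sym_rtrancl[OF symR] by (auto dest: symD)
  ultimately have "(u, u') \<in> R\<^sup>*" by auto
  then have "\<exists>p. M.awalk u p u' \<and> (\<forall>e\<in>set p. fst e \<noteq> v \<and> snd e \<noteq> v)"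
  proof (induction rule: converse_rtrancl_induct)
    case base
    have "u' \<in> pverts ?M" using arcs(2) G.in_arcsD1 by simp
    then show ?case by (intro exI[of _ "[]"]) (simp add: M.awalk_Nil_iff)
  next
    case (step y z)
    then obtain p where "M.awalk z p u'" "\<forall>e\<in>set p. fst e \<noteq> v \<and> snd e \<noteq> v" by blast
    then show ?case using step(1)
      by (intro exI[of _ "(y, z) # p"]) (auto simp: M.awalk_Cons_iff R_def)
  qed
  then obtain p where p: "M.awalk u p u'" "\<forall>e\<in>set p. fst e \<noteq> v \<and> snd e \<noteq> v" by blast
  define q where "q = M.awalk_to_apath p"
  have path: "M.apath u q u'" unfolding q_def by (rule M.apath_awalk_to_apath[OF p(1)])
  then have walk: "M.awalk u q u'" by (rule M.awalkI_apath)
  have "set q \<subseteq> set p" unfolding q_def by (rule M.awalk_to_apath_subset[OF p(1)])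
  moreover have "u \<noteq> v" using not_v[of u u] arcs by auto
  ultimately have v: "v \<notin> set (pawalk_verts u q)"
    using p(2) M.set_awalk_verts[OF walk] by auto
  \<comment> \<open>This excludes the closed walk of length 2 that runs one edge forth and
    back.\<close>
  have "q \<noteq> []" using walk ne by (auto simp: M.awalk_Nil_iff)
  let ?c = "(v, u) # q @ [(u', v)]"
  have vM: "v \<in> pverts ?M" using arcs(2) G.in_arcsD2 by simp
  have "M.awalk v ?c v"
    using walk arcs arcM symM vM by (auto simp: M.awalk_Cons_iff M.awalk_Nil_iff)
  moreover have "pawalk_verts v ?c = v # pawalk_verts u q @ [v]"
  proof -
    have "pawalk_verts u (q @ [(u', v)]) = pawalk_verts u q @ [v]"
      using M.awalk_verts_append[of u q "[(u', v)]" v] calculation walk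
      by (auto simp: M.awalk_Cons_iff)
    then show ?thesis by simp
  qed
  ultimately have "M.cycle ?c"
    using path v unfolding M.cycle_def by (auto simp: M.apath_def)
  moreover have "3 \<le> length ?c" using \<open>q \<noteq> []\<close> by (cases q) auto
  ultimately show False using no_cycle by blast
qed

text \<open>Going back along arcs terminates, by finiteness and acyclicity, and can only end in the
  unique source. So the source reaches every vertex, and \<open>unique_parent\<close> applies with
  \<open>x\<close> the source.\<close>

lemma directed_tree_imp_rooted_tree:
  assumes "directed_tree m G"
  shows "\<exists>r. rooted_tree {1..m} (parcs G) r"
proof -
  from assms have G: "pair_digraph G" "pverts G = {1..m}" "acyclic (parcs G)"
    and no_cycle: "\<not> (\<exists>p. pre_digraph.cycle (with_proj (mk_symmetric (with_proj G))) p \<and> 3 \<le> length p)"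
    and source: "\<exists>!v. v \<in> pverts G \<and> in_degree (with_proj G) v = 0"
    unfolding directed_tree_def underlying_tree_def by blast+
  interpret G: pair_digraph G by fact
  have deg: "in_degree (with_proj G) v = 0 \<longleftrightarrow> (\<forall>u. (u, v) \<notin> parcs G)" for v
    using G.finite_in_arcs[of v] by (simp add: in_degree_def in_arcs_def) blast
  from source obtain r where r0: "r \<in> {1..m}" "in_degree (with_proj G) r = 0"
    and unique: "\<And>v. v \<in> {1..m} \<Longrightarrow> in_degree (with_proj G) v = 0 \<Longrightarrow> v = r"
    unfolding G(2) by (elim ex1E) metis
  have r: "(u, r) \<notin> parcs G" for u using r0(2) deg by blast
  have parent: "\<exists>u. (u, v) \<in> parcs G" if "v \<in> {1..m}" "v \<noteq> r" for v
    using unique[OF that(1)] that(2) unfolding deg by blast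
  have reach: "(r, v) \<in> (parcs G)\<^sup>*" if "v \<in> {1..m}" for v
    using finite_acyclic_wf[OF G.pair_finite_arcs G(3)] that
  proof (induction v rule: wf_induct_rule)
    case (less v)
    show ?case
    proof (cases "v = r")
      case False
      then obtain u where u: "(u, v) \<in> parcs G" using parent less.prems by blast
      then have "u \<in> {1..m}" using G.in_arcsD1 G(2) by blast
      then show ?thesis using less.IH[OF u] u by simp
    qed simp
  qed
  have "rooted_tree {1..m} (parcs G) r"
  proof (rule rooted_tree.intro)
    show "parcs G \<subseteq> {1..m} \<times> {1..m}"
      using G.in_arcsD1 G.in_arcsD2 unfolding G(2) by auto
  next
    fix u u' v assume arcs: "(u, v) \<in> parcs G" "(u', v) \<in> parcs G"
    then have "u \<in> {1..m}" "u' \<in> {1..m}" using G.in_arcsD1 G(2) by simp_all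
    then show "u = u'" using unique_parent[OF G(1,3) no_cycle reach reach arcs] by simp
  next
    fix v assume "v \<in> {1..m}" "v \<noteq> r"
    then show "\<exists>u. (u, v) \<in> parcs G" by (rule parent)
  qed (simp_all only: finite_atLeastAtMost G(3) r0(1) r not_False_eq_True)
  then show ?thesis by blast
qed

locale rooted_digraph = rooted_tree "pverts G" "parcs G" r
  for G :: "'a pair_pre_digraph" and r :: 'a
begin

lemma vwalk_depth:
  assumes "vwalk P (with_proj G)"
  shows "depth (last P) + 1 = depth (hd P) + length P"
  using assms by (induction rule: vwalk_induct) (auto simp: depth_arc)

lemma vwalk_anc:
  assumes "vwalk P (with_proj G)"
  shows "hd P \<in> anc (last P)"
  using assms
  by (induction rule: vwalk_induct) (auto simp: anc_def intro: converse_rtrancl_into_rtrancl)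

text \<open>Read backwards from the common end, each step goes to the unique parent.\<close>

lemma vwalk_eqI:
  assumes "vwalk P (with_proj G)" "vwalk Q (with_proj G)" "last P = last Q" "length P = length Q"
  shows "P = Q"
  using assms
proof (induction P arbitrary: Q rule: rev_induct)
  case (snoc x P)
  then obtain Q' where Q: "Q = Q' @ [x]"
    by (cases Q rule: rev_cases) auto
  show ?case
  proof (cases "P = []")
    case False
    then have ne: "Q' \<noteq> []" using snoc.prems(4) Q by auto
    have "(last P, x) \<in> parcs G" "(last Q', x) \<in> parcs G"
      using snoc.prems(1,2) Q False ne by (auto simp: vwalk_def vwalk_arcs_append)
    then have "last P = last Q'" using parent_unique by blast
    moreover have "vwalk P (with_proj G)" "vwalk Q' (with_proj G)"
      using snoc.prems(1,2) Q False ne vwalkI_append_l by blast+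
    ultimately show ?thesis using snoc.IH[of Q'] snoc.prems(4) Q by simp
  qed (use snoc.prems(4) Q in simp)
qed (auto simp: vwalk_def)

lemma ex_vpath:
  assumes "a \<in> anc v" "v \<in> pverts G"
  shows "\<exists>P. vpath P (with_proj G) \<and> hd P = a \<and> last P = v"
proof -
  have "(a, v) \<in> (parcs G)\<^sup>*" using assms(1) by (simp add: anc_def)
  then have "\<exists>P. vwalk P (with_proj G) \<and> hd P = a \<and> last P = v"
  proof (induction rule: converse_rtrancl_induct)
    case base
    show ?case by (intro exI[of _ "[v]"]) (auto simp: vwalk_def assms(2))
  next
    case (step y z)
    then obtain P where P: "vwalk P (with_proj G)" "hd P = z" "last P = v" by blast
    moreover from P(1) have "P \<noteq> []" by (auto simp: vwalk_def)
    ultimately show ?case using step(1) arc_verts[of y z]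
      by (intro exI[of _ "y # P"]) (auto intro!: vwalk_consI)
  qed
  then show ?thesis using vwalk_imp_ex_vpath by metis
qed

text \<open>A trek is determined by its top: depths fix the length of each leg, and then
  \<open>vwalk_eqI\<close> fixes the leg.\<close>

lemma bij_betw_treks:
  assumes "i \<in> pverts G" "j \<in> pverts G"
  shows "bij_betw (\<lambda>T. hd (fst T)) (treks G i j) (anc i \<inter> anc j)"
proof (rule bij_betw_imageI)
  have eq: "P = Q" if "vpath P (with_proj G)" "vpath Q (with_proj G)" "hd P = hd Q" "last P = last Q"
    for P Q
    using that vwalk_depth[of P] vwalk_depth[of Q] vwalk_eqI[of P Q] by (simp add: vpath_def)
  show "inj_on (\<lambda>T. hd (fst T)) (treks G i j)"
    by (rule inj_onI) (auto simp: treks_def intro!: eq)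
  show "(\<lambda>T. hd (fst T)) ` treks G i j = anc i \<inter> anc j"
  proof (intro equalityI subsetI)
    fix a assume "a \<in> (\<lambda>T. hd (fst T)) ` treks G i j"
    then show "a \<in> anc i \<inter> anc j" using vwalk_anc by (force simp: treks_def vpath_def)
  next
    fix a assume "a \<in> anc i \<inter> anc j"
    then obtain P Q where PQ: "vpath P (with_proj G)" "hd P = a" "last P = i"
        "vpath Q (with_proj G)" "hd Q = a" "last Q = j"
      using ex_vpath assms by blast
    then have "(P, Q) \<in> treks G i j" by (auto simp: treks_def)
    then show "a \<in> (\<lambda>T. hd (fst T)) ` treks G i j" using PQ(2) by force
  qed
qed

lemma trek_length:
  assumes "T \<in> treks G i j"
  shows "trek_length T = depth i + depth j - 2 * depth (hd (fst T))"
proof -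
  obtain P Q where T: "T = (P, Q)" by (cases T)
  then have "vwalk P (with_proj G)" "vwalk Q (with_proj G)" "hd P = hd Q" "last P = i" "last Q = j"
    using assms by (auto simp: treks_def vpath_def)
  moreover from this(1,2) have "P \<noteq> []" "Q \<noteq> []" by (auto simp: vwalk_def)
  ultimately have "depth i = depth (hd P) + (length P - 1)" "depth j = depth (hd P) + (length Q - 1)"
    using vwalk_depth[of P] vwalk_depth[of Q] by (cases P; cases Q; simp)+
  then show ?thesis by (simp add: T trek_length_def)
qed

lemma trek_poly_eq:
  assumes "i \<in> pverts G" "j \<in> pverts G"
  shows "trek_poly G i j w l = w * sig i j l"
proof -
  let ?f = "\<lambda>n. w * l ^ (depth i + depth j - 2 * n)"
  have "trek_poly G i j w l = (\<Sum>T\<in>treks G i j. ?f (depth (hd (fst T))))"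
    unfolding trek_poly_def by (rule sum.cong) (simp_all add: trek_length)
  also have "\<dots> = (\<Sum>a\<in>anc i \<inter> anc j. ?f (depth a))"
    by (rule sum.reindex_bij_betw[OF bij_betw_treks[OF assms]])
  also have "\<dots> = (\<Sum>k<com i j. ?f k)"
    by (rule sum.reindex_bij_betw[OF bij_betw_depth_common_anc[OF assms(1)]])
  finally show ?thesis by (simp add: sig_def sum_distrib_left)
qed

end

section \<open>Linear forms in the ideal\<close>

text \<open>The exponent vector \<open>single v 1\<close> is the variable with index
  \<open>v\<close>.\<close>

definition lin_form :: "'v set \<Rightarrow> ('v \<Rightarrow> real) \<Rightarrow> 'v rpoly" where
  "lin_form S c = (\<Sum>v\<in>S. Poly_Mapping.single (Poly_Mapping.single v 1) (c v))"

lemma lookup_lin_form: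
  assumes "finite S" "v \<in> S"
  shows "Poly_Mapping.lookup (lin_form S c) (Poly_Mapping.single v 1) = c v"
proof -
  have inj: "Poly_Mapping.single u (1::nat) = Poly_Mapping.single v 1 \<longleftrightarrow> u = v" for u
    by (metis keys_single singleton_inject zero_neq_one)
  show ?thesis
    using assms by (simp add: lin_form_def lookup_sum lookup_single when_def inj
        del: One_nat_def)
qed

lemma keys_lin_form: "Poly_Mapping.keys (lin_form S c) \<subseteq> (\<lambda>v. Poly_Mapping.single v 1) ` S"
proof -
  have "Poly_Mapping.keys (lin_form S c)
      \<subseteq> (\<Union>v\<in>S. Poly_Mapping.keys (Poly_Mapping.single (Poly_Mapping.single v (1::nat)) (c v)))"
    unfolding lin_form_def by (rule Poly_Mapping.keys_sum)
  also have "\<dots> \<subseteq> (\<lambda>v. Poly_Mapping.single v 1) ` S" by auto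
  finally show ?thesis .
qed

lemma rpoly_eval_lin_form:
  assumes "finite S"
  shows "rpoly_eval x (lin_form S c) = (\<Sum>v\<in>S. c v * x v)"
proof -
  let ?g = "\<lambda>t. Poly_Mapping.lookup (lin_form S c) t *
    (\<Prod>v\<in>Poly_Mapping.keys t. x v ^ Poly_Mapping.lookup t v)"
  have "inj_on (\<lambda>v. Poly_Mapping.single v (1::nat)) S"
    by (rule inj_onI) (metis keys_single singleton_inject zero_neq_one)
  moreover have "rpoly_eval x (lin_form S c) = (\<Sum>t\<in>(\<lambda>v. Poly_Mapping.single v 1) ` S. ?g t)"
    unfolding rpoly_eval_def
    \<comment> \<open>Coefficients \<open>c v\<close> may vanish, so the keys can be fewer than the
      variables; the extra terms are 0.\<close>
    using assms keys_lin_form by (intro sum.mono_neutral_left) (auto simp: in_keys_iff)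
  ultimately have "rpoly_eval x (lin_form S c) = (\<Sum>v\<in>S. ?g (Poly_Mapping.single v 1))"
    by (simp add: sum.reindex)
  then show ?thesis using assms by (simp add: lookup_lin_form del: One_nat_def)
qed

text \<open>The zero set of a polynomial vanishing on \<open>A\<close> is closed and contains
  \<open>A\<close>, hence contains the closure.\<close>

lemma vanishing_ideal_zariski_closure:
  assumes "A \<subseteq> S \<rightarrow>\<^sub>E UNIV"
  shows "vanishing_ideal S (zariski_closure S A) = vanishing_ideal S A"
proof -
  have "rpoly_eval x f = 0"
    if f: "f \<in> poly_ring S" "\<forall>a\<in>A. rpoly_eval a f = 0" and x: "x \<in> zariski_closure S A" for f x
  proof -
    let ?Z = "{y \<in> S \<rightarrow>\<^sub>E UNIV. \<forall>g\<in>{f}. rpoly_eval y g = 0}"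
    have "zariski_closed S ?Z" unfolding zariski_closed_def using f by blast
    moreover have "A \<subseteq> ?Z" using assms f by auto
    ultimately have "zariski_closure S A \<subseteq> ?Z"
      unfolding zariski_closure_def by (intro hull_minimal)
    then show ?thesis using x by auto
  qed
  moreover have "A \<subseteq> zariski_closure S A" unfolding zariski_closure_def by (rule hull_subset)
  ultimately show ?thesis unfolding vanishing_ideal_def by blast
qed

lemma finite_sym_index: "finite (sym_index m)"
  by (rule finite_subset[of _ "{1..m} \<times> {1..m}"]) (auto simp: sym_index_def)

lemma lin_form_in_tree_ideal_iff:
  "lin_form (sym_index m) c \<in> degree_component 1 (tree_ideal m G) \<longleftrightarrow>
    (\<forall>w l. (\<Sum>(i, j)\<in>sym_index m. c (i, j) * trek_poly G i j w l) = 0)"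
proof -
  let ?S = "sym_index m"
  have "lin_form ?S c \<in> poly_ring ?S"
    using keys_lin_form[of ?S c] by (auto simp: poly_ring_def)
  moreover have "(\<Sum>v\<in>Poly_Mapping.keys t. Poly_Mapping.lookup t v) = 1"
    if "t \<in> Poly_Mapping.keys (lin_form ?S c)" for t
    using that keys_lin_form[of ?S c] by auto
  moreover have "range (param_map m G) \<subseteq> ?S \<rightarrow>\<^sub>E UNIV"
    by (auto simp: param_map_def)
  then have "tree_ideal m G = vanishing_ideal ?S (range (param_map m G))"
    unfolding tree_ideal_def tree_variety_def by (rule vanishing_ideal_zariski_closure)
  ultimately have "lin_form ?S c \<in> degree_component 1 (tree_ideal m G) \<longleftrightarrow>
      (\<forall>w l. rpoly_eval (param_map m G (w, l)) (lin_form ?S c) = 0)"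
    by (simp add: degree_component_def vanishing_ideal_def)
  moreover have "rpoly_eval (param_map m G (w, l)) (lin_form ?S c) =
      (\<Sum>(i, j)\<in>?S. c (i, j) * trek_poly G i j w l)" for w l
    by (auto simp: rpoly_eval_lin_form finite_sym_index param_map_def intro!: sum.cong)
  ultimately show ?thesis by simp
qed

text \<open>Coordinates exist only for \<open>i \<le> j\<close>; this one carries the symmetric
  covariance of \<open>i\<close> and \<open>j\<close>.\<close>

definition sorted_pair :: "nat \<Rightarrow> nat \<Rightarrow> nat \<times> nat" where
  "sorted_pair i j = (min i j, max i j)"

text \<open>The coefficients \<open>h\<close> do not depend on \<open>G\<close>, so equal degree 1
  components transfer the relation between trees. Indicators are added, so coinciding pairs
  accumulate correctly.\<close>

lemma relation_iff:
  assumes "rooted_digraph G r" "pverts G = {1..m}" "{a, b, c, d, e, f} \<subseteq> {1..m}"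
  defines "h \<equiv> \<lambda>v. of_bool (v = sorted_pair a b) + of_bool (v = sorted_pair c d)
    - of_bool (v = sorted_pair e f)"
  shows "lin_form (sym_index m) h \<in> degree_component 1 (tree_ideal m G) \<longleftrightarrow>
    (\<forall>l. rooted_tree.sig (parcs G) a b l + rooted_tree.sig (parcs G) c d l
      = rooted_tree.sig (parcs G) e f l)"
proof -
  interpret rooted_digraph G r by fact
  define t where "t = (\<lambda>w l (i, j). trek_poly G i j w l)"
  have t: "t w l (sorted_pair i j) = w * sig i j l" and s: "sorted_pair i j \<in> sym_index m"
    if "i \<in> {1..m}" "j \<in> {1..m}" for i j w l
    using that trek_poly_eq[of i j] trek_poly_eq[of j i] assms(2) sig_commute[of i j]
    by (auto simp: t_def sorted_pair_def sym_index_def min_def max_def)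
  have single: "(\<Sum>v\<in>sym_index m. of_bool (v = u) * t w l v) = t w l u" if "u \<in> sym_index m" for u w l
  proof -
    have "of_bool (v = u) * t w l v = (if v = u then t w l v else 0)" for v by simp
    then show ?thesis using that finite_sym_index by simp
  qed
  have "(\<Sum>(i, j)\<in>sym_index m. h (i, j) * trek_poly G i j w l)
      = w * (sig a b l + sig c d l - sig e f l)" for w l
  proof -
    have "(\<Sum>(i, j)\<in>sym_index m. h (i, j) * trek_poly G i j w l) = (\<Sum>v\<in>sym_index m. h v * t w l v)"
      by (rule sum.cong) (auto simp: t_def)
    also have "\<dots> = t w l (sorted_pair a b) + t w l (sorted_pair c d) - t w l (sorted_pair e f)"
      using assms(3) s by (simp add: h_def distrib_right left_diff_distrib sum.distrib sum_subtractf single)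
    also have "\<dots> = w * (sig a b l + sig c d l - sig e f l)"
      using assms(3) t by (simp add: algebra_simps)
    finally show ?thesis .
  qed
  then have "lin_form (sym_index m) h \<in> degree_component 1 (tree_ideal m G) \<longleftrightarrow>
      (\<forall>w l. w * (sig a b l + sig c d l - sig e f l) = 0)"
    by (simp only: lin_form_in_tree_ideal_iff)
  \<comment> \<open>Setting \<open>w = 1\<close> removes the common factor.\<close>
  also have "\<dots> \<longleftrightarrow> (\<forall>l. sig a b l + sig c d l = sig e f l)"
    by (auto dest: spec[of _ 1])
  finally show ?thesis .
qed

theorem theorem8p2:
  fixes m :: nat and G H :: "nat pair_pre_digraph"
  assumes "m \<noteq> 2"
    and "directed_tree m G"
    and "directed_tree m H"
    and "degree_component 1 (tree_ideal m G) = degree_component 1 (tree_ideal m H)"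
  shows "H = G"
proof -
  have verts: "pverts G = {1..m}" "pverts H = {1..m}"
    using assms(2,3) by (simp_all add: directed_tree_def)
  obtain r r' where trees: "rooted_tree {1..m} (parcs G) r" "rooted_tree {1..m} (parcs H) r'"
    using assms(2,3) directed_tree_imp_rooted_tree by blast
  then have digraphs: "rooted_digraph G r" "rooted_digraph H r'"
    by (simp_all add: rooted_digraph_def verts)
  interpret related_trees "{1..m}" "parcs G" "parcs H" r r'
  proof (intro related_trees.intro related_trees_axioms.intro trees)
    fix a b c d e f :: nat assume "{a, b, c, d, e, f} \<subseteq> {1..m}"
    then show "(\<forall>l. rooted_tree.sig (parcs G) a b l + rooted_tree.sig (parcs G) c d l
          = rooted_tree.sig (parcs G) e f l) \<longleftrightarrow>
        (\<forall>l. rooted_tree.sig (parcs H) a b l + rooted_tree.sig (parcs H) c d l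
          = rooted_tree.sig (parcs H) e f l)"
      using relation_iff[OF digraphs(1) verts(1)] relation_iff[OF digraphs(2) verts(2)] assms(4)
      by simp
  qed
  have "parcs H = parcs G"
  proof (cases "3 \<le> m")
    case True
    then show ?thesis by (intro arcs_eq) simp
  next
    case False
    then have "m \<le> 1" using assms(1) by simp
    \<comment> \<open>With at most one vertex, an arc would be a loop.\<close>
    have no_arcs: "E = {}" if E: "rooted_tree {1..m} E x" for E and x
    proof (rule ccontr)
      assume "E \<noteq> {}"
      then obtain u v where uv: "(u, v) \<in> E" by auto
      then have "u = v" using rooted_tree.arcs_subset[OF E] \<open>m \<le> 1\<close> by auto
      then show False using uv rooted_tree.acyclic_arcs[OF E] by (auto simp: acyclic_def)
    qed
    show ?thesis using no_arcs[OF trees(1)] no_arcs[OF trees(2)] by simp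
  qed
  then show ?thesis using verts by (simp add: pair_pre_digraph.equality)
qed

end
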